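(* Let $N\ge 1$ be an integer, and for $1\le p<\infty$ let $$C(p)=\sup\left\{\frac{|\mathrm{perm}[\vec f_1,\dots,\vec f_N]|}{\prod_{j=1}^N|\vec f_j|_p}\ :\ \vec f_1,\dots,\vec f_N\in\mathbb{C}^N\setminus\{0\}\right\}.$$ Then $\ln(C(p))$ is a convex function of $1/p$. In particular, for all $1\le p\le 2$, $$C(p)\le\left(\frac{N!}{N^{N/2}}\right)^{2-2/p}.$$
   Context: For $1\le p<\infty$ and $\vec f\in\mathbb{C}^N$ with entries $(\vec f)_k$, $|\vec f|_p=\left(\sum_{k=1}^N|(\vec f)_k|^p\right)^{1/p}$. $[\vec f_1,\dots,\vec f_N]$ denotes the $N\times N$ matrix whose $j$th column is $\vec f_j$. The permanent of an $N\times N$ matrix $F=(F_{i,j})$ is $\mathrm{perm}(F)=\sum_\sigma\prod_{j=1}^N F_{\sigma(j),j}$, the sum being over all permutations $\sigma$ of $\{1,\dots,N\}$. The first assertion means that the function $s\mapsto \ln C(1/s)$ is convex on $(0,1]$. *)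

theory Defs
  imports "HOL-Analysis.Analysis"
begin

text \<open>The dimension \<open>N \<ge> 1\<close> is \<open>CARD('n)\<close> for a finite index type \<open>'n\<close>.\<close>

definition lpnorm :: "real \<Rightarrow> complex ^ 'n \<Rightarrow> real" where
  "lpnorm p x = (\<Sum>k\<in>UNIV. cmod (x $ k) powr p) powr (1 / p)"

definition permanent :: "complex ^ 'n ^ 'n \<Rightarrow> complex" where
  "permanent F = (\<Sum>\<sigma> | \<sigma> permutes (UNIV :: 'n set). \<Prod>j\<in>UNIV. F $ \<sigma> j $ j)"

definition matrix_of_columns :: "('n \<Rightarrow> complex ^ 'n) \<Rightarrow> complex ^ 'n ^ 'n" where
  "matrix_of_columns f = (\<chi> i j. f j $ i)"

definition perm_ratios :: "'n::finite itself \<Rightarrow> real \<Rightarrow> real set" where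
  "perm_ratios _ p =
     {cmod (permanent (matrix_of_columns f)) / (\<Prod>j\<in>UNIV. lpnorm p (f j)) |
        f :: 'n \<Rightarrow> complex ^ 'n. \<forall>j. f j \<noteq> 0}"

definition perm_const :: "'n::finite itself \<Rightarrow> real \<Rightarrow> real" where
  "perm_const N p = Sup (perm_ratios N p)"

lemma column_matrix_of_columns: "column j (matrix_of_columns f) = f j"
  by (simp add: column_def matrix_of_columns_def vec_eq_iff)

text \<open>
  The real-valued supremum and logarithm return arbitrary values on unbounded sets and on
  nonpositive numbers; the facts below show that neither case arises for \<open>p \<ge> 1\<close>.
\<close>

lemma cmod_nth_le_lpnorm:
  fixes x :: "complex ^ 'n"
  assumes "p \<ge> 1"
  shows "cmod (x $ k) \<le> lpnorm p x"
proof -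
  have "cmod (x $ k) powr p \<le> (\<Sum>k\<in>UNIV. cmod (x $ k) powr p)"
    by (rule member_le_sum) auto
  then have "(cmod (x $ k) powr p) powr (1 / p) \<le> lpnorm p x"
    unfolding lpnorm_def using assms by (intro powr_mono2) auto
  then show ?thesis
    using assms by (simp add: powr_powr)
qed

lemma lpnorm_pos:
  fixes x :: "complex ^ 'n"
  assumes "p \<ge> 1" and "x \<noteq> 0"
  shows "lpnorm p x > 0"
proof -
  obtain k where "x $ k \<noteq> 0"
    using assms(2) by (auto simp: vec_eq_iff)
  then show ?thesis
    using cmod_nth_le_lpnorm[OF assms(1), of x k] by (smt (verit) zero_less_norm_iff)
qed

lemma perm_ratios_bdd_above:
  assumes "p \<ge> 1"
  shows "bdd_above (perm_ratios TYPE('n::finite) p)"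
proof (rule bdd_aboveI)
  fix r assume "r \<in> perm_ratios TYPE('n) p"
  then obtain f :: "'n \<Rightarrow> complex ^ 'n" where nz: "\<And>j. f j \<noteq> 0"
    and r: "r = cmod (permanent (matrix_of_columns f)) / (\<Prod>j\<in>UNIV. lpnorm p (f j))"
    unfolding perm_ratios_def by blast
  define D where "D = (\<Prod>j\<in>UNIV. lpnorm p (f j))"
  have D: "D > 0"
    unfolding D_def by (intro prod_pos) (simp add: lpnorm_pos[OF assms nz])
  have "cmod (permanent (matrix_of_columns f))
      \<le> (\<Sum>\<sigma> | \<sigma> permutes (UNIV :: 'n set). \<Prod>j\<in>UNIV. cmod (f j $ \<sigma> j))"
    unfolding permanent_def matrix_of_columns_def
    by (rule order.trans[OF norm_sum]) (simp add: prod_norm)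
  also have "\<dots> \<le> (\<Sum>\<sigma> | \<sigma> permutes (UNIV :: 'n set). D)"
    unfolding D_def by (intro sum_mono prod_mono) (simp add: cmod_nth_le_lpnorm[OF assms])
  also have "\<dots> = fact CARD('n) * D"
    by (simp add: card_permutations)
  finally show "r \<le> fact CARD('n)"
    using D by (simp add: r D_def[symmetric] divide_le_eq)
qed

lemma perm_const_ge_1:
  assumes "p \<ge> 1"
  shows "perm_const TYPE('n::finite) p \<ge> 1"
proof -
  define f where "f = (\<lambda>j :: 'n. axis j (1 :: complex))"
  have nz: "\<forall>j. f j \<noteq> 0"
    by (simp add: f_def axis_eq_0_iff)
  have norm1: "lpnorm p (f j) = 1" for j
  proof -
    have "(\<Sum>k\<in>UNIV. cmod (f j $ k) powr p) = (\<Sum>k\<in>UNIV. if k = j then 1 else 0)"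
      by (rule sum.cong) (auto simp: f_def axis_def)
    then show ?thesis
      by (simp add: lpnorm_def)
  qed
  have "(\<Prod>j\<in>UNIV. f j $ \<sigma> j) = (if \<sigma> = id then 1 else 0)" for \<sigma> :: "'n \<Rightarrow> 'n"
  proof (cases "\<sigma> = id")
    case False
    then obtain j where "\<sigma> j \<noteq> j"
      by (auto simp: fun_eq_iff)
    then have "f j $ \<sigma> j = 0"
      by (simp add: f_def axis_def)
    then have "(\<Prod>j\<in>UNIV. f j $ \<sigma> j) = 0"
      by (meson UNIV_I finite prod_zero)
    with False show ?thesis
      by simp
  qed (simp add: f_def axis_def)
  then have "permanent (matrix_of_columns f) = 1"
    by (simp add: permanent_def matrix_of_columns_def permutes_id)
  then have "1 \<in> perm_ratios TYPE('n) p"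
    unfolding perm_ratios_def using nz norm1
    by (auto intro!: exI[of _ f])
  then show ?thesis
    unfolding perm_const_def by (intro cSup_upper perm_ratios_bdd_above assms)
qed

end

theory Submission
  imports Defs
begin

text \<open>
  Replacing the entries of a matrix by their absolute values does not change the column norms and
  does not decrease the modulus of the permanent. So \<open>C(p)\<close> is the best constant for matrices with
  nonnegative entries, and all complex interpolation theory can be avoided.

  Log-convexity. Write a nonnegative matrix as \<open>a\<^sup>s\<close> (entrywise) with \<open>s = 1/p = (1 - t) x + t y\<close>.
  Each product in its permanent is the weighted geometric mean of the corresponding products for
  \<open>a\<^sup>x\<close> and \<open>a\<^sup>y\<close>, so Hoelder's inequality for the sum over permutations
  bounds the permanent by the geometric mean of those of \<open>a\<^sup>x\<close> and \<open>a\<^sup>y\<close>. The norm of a column of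
  \<open>a\<^sup>s\<close> with exponent \<open>1/s\<close> is the \<open>s\<close>-th power of the corresponding column sum of \<open>a\<close>, so the norms
  interpolate without loss (\<open>perm_const_interpolate\<close>).

  The endpoints. \<open>C(1) \<le> 1\<close> because the product of the column sums expands into a sum over all maps
  of the index set, the permutations being some of them. \<open>C(2) \<le> N! / N\<^bsup>N/2\<^esup>\<close> is an
  instance of Banach's theorem that a symmetric multilinear form on a Hilbert space attains its norm
  on the diagonal: for equal columns \<open>w\<close> the permanent is \<open>N! \<Prod>\<^sub>k w\<^sub>k\<close>, which the
  inequality of the means controls. For nonnegative vectors Banach's theorem has a short proof by
  compactness. If two vectors \<open>x\<close> and \<open>y\<close> of a maximizing tuple of unit vectors are both replaced by
  \<open>(x + y) / |x + y|\<close>, the tuple remains maximizing (\<open>maximizer_merge\<close>), while the sum of all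
  entries of the tuple strictly increases unless \<open>x = y\<close>. Hence a maximizer whose
  entry sum is largest has all its vectors equal. The bound for
  \<open>1 \<le> p \<le> 2\<close> follows by interpolating between these two endpoints.
\<close>

section \<open>Permanents of nonnegative matrices\<close>

text \<open>
  A matrix is represented by the family of its columns, so that exchanging a single column is a
  function update.
\<close>

definition rperm :: "('n::finite \<Rightarrow> real ^ 'n) \<Rightarrow> real" where
  "rperm g = (\<Sum>\<sigma> | \<sigma> permutes (UNIV :: 'n set). \<Prod>j\<in>UNIV. g j $ \<sigma> j)"

definition pnorm :: "real \<Rightarrow> real ^ 'n::finite \<Rightarrow> real" where
  "pnorm p x = (\<Sum>k\<in>UNIV. x $ k powr p) powr (1 / p)"

lemma rperm_nonneg:
  assumes "\<And>j k. g j $ k \<ge> 0"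
  shows "rperm g \<ge> 0"
  unfolding rperm_def by (intro sum_nonneg prod_nonneg) (use assms in auto)

lemma rperm_scale: "rperm (\<lambda>j. c j *\<^sub>R g j) = (\<Prod>j\<in>UNIV. c j) * rperm g"
  by (simp add: rperm_def prod.distrib sum_distrib_left)

lemma rperm_diagonal: "rperm (\<lambda>_. w :: real ^ 'n::finite) = fact CARD('n) * (\<Prod>k\<in>UNIV. w $ k)"
proof -
  have "(\<Prod>j\<in>UNIV. w $ \<sigma> j) = (\<Prod>k\<in>UNIV. w $ k)" if "\<sigma> permutes UNIV" for \<sigma> :: "'n \<Rightarrow> 'n"
    using prod.permute[OF that, of "\<lambda>k. w $ k"] by (simp add: o_def)
  then show ?thesis
    by (simp add: rperm_def card_permutations)
qed

lemma rperm_permute_columns: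
  fixes g :: "'n::finite \<Rightarrow> real ^ 'n"
  assumes "\<pi> permutes UNIV"
  shows "rperm (g \<circ> \<pi>) = rperm g"
proof -
  have "rperm (g \<circ> \<pi>) =
      (\<Sum>\<sigma> | \<sigma> permutes (UNIV :: 'n set). \<Prod>j\<in>UNIV. g (\<pi> j) $ (\<sigma> \<circ> \<pi>) j)"
    unfolding rperm_def
    by (subst sum_permutations_compose_right[OF assms]) simp
  moreover have "(\<Prod>j\<in>UNIV. g (\<pi> j) $ (\<sigma> \<circ> \<pi>) j) = (\<Prod>j\<in>UNIV. g j $ \<sigma> j)" for \<sigma>
    using prod.permute[OF assms, of "\<lambda>j. g j $ \<sigma> j"] by (simp add: o_def)
  ultimately show ?thesis
    by (simp add: rperm_def)
qed

lemma rperm_swap: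
  fixes g :: "'n::finite \<Rightarrow> real ^ 'n"
  assumes "i \<noteq> j"
  shows "rperm (g(i := x, j := y)) = rperm (g(i := y, j := x))"
proof -
  have "g(i := x, j := y) \<circ> Transposition.transpose i j = g(i := y, j := x)"
    using assms by (auto simp: fun_eq_iff Transposition.transpose_def)
  moreover have "Transposition.transpose i j permutes UNIV"
    by (simp add: permutes_swap_id)
  ultimately show ?thesis
    by (metis rperm_permute_columns)
qed

text \<open>As a function of a single column the permanent is a linear functional; the vector of
  complementary permanental minors represents it.\<close>

lemma rperm_linear_in_column:
  fixes g :: "'n::finite \<Rightarrow> real ^ 'n"
  assumes "\<And>j k. g j $ k \<ge> 0"
  obtains v where "\<And>k. v $ k \<ge> 0" and "\<And>z. rperm (g(i := z)) = v \<bullet> z"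
proof
  define P where "P = (\<lambda>\<sigma> :: 'n \<Rightarrow> 'n. \<Prod>j\<in>UNIV - {i}. g j $ \<sigma> j)"
  define v :: "real ^ 'n" where
    "v = (\<chi> k. \<Sum>\<sigma> | \<sigma> permutes (UNIV :: 'n set). if \<sigma> i = k then P \<sigma> else 0)"
  have "P \<sigma> \<ge> 0" for \<sigma>
    unfolding P_def by (intro prod_nonneg) (use assms in auto)
  then show "v $ k \<ge> 0" for k
    unfolding v_def by (auto intro!: sum_nonneg)
  show "rperm (g(i := z)) = v \<bullet> z" for z
  proof -
    have "rperm (g(i := z)) = (\<Sum>\<sigma> | \<sigma> permutes (UNIV :: 'n set). P \<sigma> * z $ \<sigma> i)"
      unfolding rperm_def P_def
      by (intro sum.cong refl, subst prod.remove[of UNIV i]) (auto intro!: prod.cong)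
    also have "\<dots> = (\<Sum>\<sigma> | \<sigma> permutes (UNIV :: 'n set).
        \<Sum>k\<in>UNIV. (if \<sigma> i = k then P \<sigma> else 0) * z $ k)"
      by (intro sum.cong refl) (simp add: if_distrib[of "\<lambda>x. x * _"] cong: if_cong)
    also have "\<dots> = v \<bullet> z"
      by (subst sum.swap) (simp add: inner_vec_def v_def sum_distrib_right)
    finally show ?thesis .
  qed
qed

section \<open>Reduction to nonnegative matrices\<close>

lemma rperm_le_perm_const:
  fixes g :: "'n::finite \<Rightarrow> real ^ 'n"
  assumes p: "p \<ge> 1" and nonneg: "\<And>j k. g j $ k \<ge> 0" and nz: "\<And>j. g j \<noteq> 0"
  shows "rperm g \<le> perm_const TYPE('n) p * (\<Prod>j\<in>UNIV. pnorm p (g j))"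
proof -
  define f :: "'n \<Rightarrow> complex ^ 'n" where "f = (\<lambda>j. \<chi> k. of_real (g j $ k))"
  have f_nz: "f j \<noteq> 0" for j
    using nz[of j] by (auto simp: f_def vec_eq_iff)
  have norm_f: "lpnorm p (f j) = pnorm p (g j)" for j
    by (simp add: lpnorm_def pnorm_def f_def nonneg)
  have "permanent (matrix_of_columns f) = of_real (rperm g)"
    by (simp add: permanent_def matrix_of_columns_def f_def rperm_def)
  then have "cmod (permanent (matrix_of_columns f)) = rperm g"
    by (simp add: rperm_nonneg nonneg)
  then have "rperm g / (\<Prod>j\<in>UNIV. pnorm p (g j)) \<in> perm_ratios TYPE('n) p"
    unfolding perm_ratios_def using f_nz norm_f by (auto intro!: exI[of _ f])
  then have "rperm g / (\<Prod>j\<in>UNIV. pnorm p (g j)) \<le> perm_const TYPE('n) p"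
    unfolding perm_const_def by (intro cSup_upper perm_ratios_bdd_above p)
  moreover have "(\<Prod>j\<in>UNIV. pnorm p (g j)) > 0"
    unfolding norm_f[symmetric] by (intro prod_pos) (simp add: lpnorm_pos[OF p f_nz])
  ultimately show ?thesis
    by (simp add: pos_divide_le_eq)
qed

lemma perm_const_leI:
  assumes p: "p \<ge> 1"
    and bound: "\<And>g :: 'n::finite \<Rightarrow> real ^ 'n. (\<And>j k. g j $ k \<ge> 0) \<Longrightarrow> (\<And>j. g j \<noteq> 0) \<Longrightarrow>
      rperm g \<le> B * (\<Prod>j\<in>UNIV. pnorm p (g j))"
  shows "perm_const TYPE('n) p \<le> B"
  unfolding perm_const_def
proof (rule cSup_least)
  have "\<forall>j :: 'n. axis j (1 :: complex) \<noteq> 0"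
    by simp
  then show "perm_ratios TYPE('n) p \<noteq> {}"
    unfolding perm_ratios_def by (auto intro: exI[of _ "\<lambda>j. axis j 1"])
next
  fix r assume "r \<in> perm_ratios TYPE('n) p"
  then obtain f :: "'n \<Rightarrow> complex ^ 'n" where nz: "\<And>j. f j \<noteq> 0"
    and r: "r = cmod (permanent (matrix_of_columns f)) / (\<Prod>j\<in>UNIV. lpnorm p (f j))"
    unfolding perm_ratios_def by blast
  define g :: "'n \<Rightarrow> real ^ 'n" where "g = (\<lambda>j. \<chi> k. cmod (f j $ k))"
  have "cmod (permanent (matrix_of_columns f)) \<le> rperm g"
    unfolding permanent_def matrix_of_columns_def rperm_def g_def
    by (rule order.trans[OF norm_sum]) (simp add: prod_norm)
  also have "\<dots> \<le> B * (\<Prod>j\<in>UNIV. pnorm p (g j))"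
  proof (rule bound)
    show "g j $ k \<ge> 0" for j k by (simp add: g_def)
    show "g j \<noteq> 0" for j using nz[of j] by (auto simp: g_def vec_eq_iff)
  qed
  also have "\<dots> = B * (\<Prod>j\<in>UNIV. lpnorm p (f j))"
    by (simp add: pnorm_def lpnorm_def g_def)
  finally have "cmod (permanent (matrix_of_columns f)) \<le> B * (\<Prod>j\<in>UNIV. lpnorm p (f j))" .
  moreover have "(\<Prod>j\<in>UNIV. lpnorm p (f j)) > 0"
    by (intro prod_pos) (simp add: lpnorm_pos[OF p nz])
  ultimately show "r \<le> B"
    by (simp add: r pos_divide_le_eq)
qed

section \<open>Interpolation\<close>

text \<open>Hoelder's inequality with exponents \<open>1/(1 - t)\<close> and \<open>1/t\<close>: after division by the two sums it
  is the weighted inequality of the means, summed over the index set.\<close>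

lemma sum_geometric_mean_le:
  fixes u v :: "'a \<Rightarrow> real"
  assumes "finite A" and u: "\<And>x. x \<in> A \<Longrightarrow> u x \<ge> 0" and v: "\<And>x. x \<in> A \<Longrightarrow> v x \<ge> 0"
    and t: "0 < t" "t < 1"
  shows "(\<Sum>x\<in>A. u x powr (1 - t) * v x powr t) \<le> sum u A powr (1 - t) * sum v A powr t"
proof (cases "sum u A = 0 \<or> sum v A = 0")
  case True
  then have "u x = 0 \<or> v x = 0" if "x \<in> A" for x
    using that u v \<open>finite A\<close> by (metis sum_nonneg_eq_0_iff)
  then have "(\<Sum>x\<in>A. u x powr (1 - t) * v x powr t) = 0"
    by (intro sum.neutral) fastforce
  then show ?thesis
    by simp
next
  case False
  define U V where "U = sum u A" and "V = sum v A"
  have UV: "U > 0" "V > 0"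
    using False u v by (simp_all add: U_def V_def sum_nonneg order_less_le)
  have "u x powr (1 - t) * v x powr t
      \<le> U powr (1 - t) * V powr t * ((1 - t) * (u x / U) + t * (v x / V))" if x: "x \<in> A" for x
  proof (cases "u x = 0 \<or> v x = 0")
    case True
    moreover have "0 \<le> U powr (1 - t) * V powr t * ((1 - t) * (u x / U) + t * (v x / V))"
      using u[OF x] v[OF x] UV t by (intro mult_nonneg_nonneg add_nonneg_nonneg) auto
    ultimately show ?thesis
      by auto
  next
    case False
    then have pos: "u x > 0" "v x > 0"
      using u[OF x] v[OF x] by auto
    have "(u x / U) powr (1 - t) * (v x / V) powr t \<le> (1 - t) * (u x / U) + t * (v x / V)"
      using t pos UV by (intro Youngs_inequality_0) auto
    then have "U powr (1 - t) * V powr t * ((u x / U) powr (1 - t) * (v x / V) powr t)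
        \<le> U powr (1 - t) * V powr t * ((1 - t) * (u x / U) + t * (v x / V))"
      by (intro mult_left_mono) auto
    then show ?thesis
      using UV pos by (simp add: powr_divide)
  qed
  then have "(\<Sum>x\<in>A. u x powr (1 - t) * v x powr t)
      \<le> (\<Sum>x\<in>A. U powr (1 - t) * V powr t * ((1 - t) * (u x / U) + t * (v x / V)))"
    by (rule sum_mono)
  also have "\<dots> = U powr (1 - t) * V powr t * ((1 - t) * (sum u A / U) + t * (sum v A / V))"
    by (simp add: sum_distrib_left[symmetric] sum.distrib sum_divide_distrib[symmetric])
  also have "\<dots> = U powr (1 - t) * V powr t"
    using UV by (simp add: U_def[symmetric] V_def[symmetric])
  finally show ?thesis
    by (simp add: U_def V_def)
qed

lemma rperm_geometric_mean_le:
  fixes a :: "'n::finite \<Rightarrow> 'n \<Rightarrow> real"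
  assumes a: "\<And>j k. a j k \<ge> 0" and t: "0 < t" "t < 1"
  shows "rperm (\<lambda>j. \<chi> k. a j k powr ((1 - t) * x + t * y))
    \<le> rperm (\<lambda>j. \<chi> k. a j k powr x) powr (1 - t) * rperm (\<lambda>j. \<chi> k. a j k powr y) powr t"
proof -
  have "a j k powr ((1 - t) * x + t * y)
      = (a j k powr x) powr (1 - t) * (a j k powr y) powr t" for j k
    by (simp add: powr_add powr_powr mult.commute)
  then have "rperm (\<lambda>j. \<chi> k. a j k powr ((1 - t) * x + t * y))
      = (\<Sum>\<sigma> | \<sigma> permutes (UNIV :: 'n set). (\<Prod>j\<in>UNIV. a j (\<sigma> j) powr x) powr (1 - t)
          * (\<Prod>j\<in>UNIV. a j (\<sigma> j) powr y) powr t)"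
    by (simp add: rperm_def prod.distrib prod_powr_distrib)
  also have "\<dots> \<le> rperm (\<lambda>j. \<chi> k. a j k powr x) powr (1 - t)
      * rperm (\<lambda>j. \<chi> k. a j k powr y) powr t"
    unfolding rperm_def vec_lambda_beta
    by (rule sum_geometric_mean_le) (use t in \<open>auto intro!: prod_nonneg finite_permutations\<close>)
  finally show ?thesis .
qed

lemma pnorm_powr:
  fixes b :: "'n::finite \<Rightarrow> real"
  assumes "\<And>k. b k \<ge> 0" and "s > 0"
  shows "pnorm (1 / s) (\<chi> k. b k powr s) = (\<Sum>k\<in>UNIV. b k) powr s"
  using assms by (simp add: pnorm_def powr_powr)

lemma perm_const_interpolate:
  assumes x: "0 < x" "x \<le> 1" and y: "0 < y" "y \<le> 1" and t: "0 < t" "t < 1"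
  shows "perm_const TYPE('n::finite) (1 / ((1 - t) * x + t * y))
    \<le> perm_const TYPE('n) (1 / x) powr (1 - t) * perm_const TYPE('n) (1 / y) powr t"
proof (rule perm_const_leI)
  define s where "s = (1 - t) * x + t * y"
  have "s > 0"
    using x y t by (simp add: s_def add_pos_pos)
  moreover have "s \<le> 1"
    using x y t convex_bound_le[of x 1 y "1 - t" t] by (simp add: s_def)
  ultimately show "1 / ((1 - t) * x + t * y) \<ge> 1"
    by (simp add: s_def)
  fix g :: "'n \<Rightarrow> real ^ 'n"
  assume nonneg: "\<And>j k. g j $ k \<ge> 0" and nz: "\<And>j. g j \<noteq> 0"
  define a where "a = (\<lambda>j k. g j $ k powr (1 / s))"
  have a: "a j k \<ge> 0" for j k
    by (simp add: a_def)
  have g: "g = (\<lambda>j. \<chi> k. a j k powr s)"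
    using \<open>s > 0\<close> nonneg by (simp add: fun_eq_iff vec_eq_iff a_def powr_powr)
  define S where "S = (\<lambda>j. \<Sum>k\<in>UNIV. a j k)"
  define C where "C = (\<lambda>r. perm_const TYPE('n) (1 / r))"
  define Q where "Q = (\<lambda>r. \<Prod>j\<in>UNIV. S j powr r)"
  have C: "C r \<ge> 0" if "0 < r" "r \<le> 1" for r
    using perm_const_ge_1[where 'n = 'n, of "1 / r"] that by (simp add: C_def)
  have Q: "Q r \<ge> 0" for r
    unfolding Q_def by (intro prod_nonneg) auto
  have bound: "rperm (\<lambda>j. \<chi> k. a j k powr r) \<le> C r * Q r" if r: "0 < r" "r \<le> 1" for r
  proof -
    have nz': "(\<chi> k. a j k powr r) \<noteq> 0" for j
      using nz[of j] by (auto simp: vec_eq_iff a_def)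
    have "rperm (\<lambda>j. \<chi> k. a j k powr r)
        \<le> C r * (\<Prod>j\<in>UNIV. pnorm (1 / r) (\<chi> k. a j k powr r))"
      unfolding C_def by (rule rperm_le_perm_const) (use r nz' in auto)
    also have "\<dots> = C r * Q r"
      using r a by (simp add: pnorm_powr Q_def S_def)
    finally show ?thesis .
  qed
  have "rperm g \<le> rperm (\<lambda>j. \<chi> k. a j k powr x) powr (1 - t)
      * rperm (\<lambda>j. \<chi> k. a j k powr y) powr t"
    unfolding g s_def using a t by (rule rperm_geometric_mean_le)
  also have "\<dots> \<le> (C x * Q x) powr (1 - t) * (C y * Q y) powr t"
    using x y t by (intro mult_mono powr_mono2 bound rperm_nonneg) auto
  also have "\<dots> = C x powr (1 - t) * C y powr t * (Q x powr (1 - t) * Q y powr t)"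
    using C[OF x] C[OF y] Q by (simp add: powr_mult)
  also have "Q x powr (1 - t) * Q y powr t = Q s"
    by (simp add: Q_def s_def prod_powr_distrib powr_powr powr_add prod.distrib mult.commute)
  also have "Q s = (\<Prod>j\<in>UNIV. pnorm (1 / s) (g j))"
    unfolding g using \<open>s > 0\<close> a by (simp add: pnorm_powr Q_def S_def)
  finally show "rperm g \<le> perm_const TYPE('n) (1 / x) powr (1 - t)
      * perm_const TYPE('n) (1 / y) powr t
      * (\<Prod>j\<in>UNIV. pnorm (1 / ((1 - t) * x + t * y)) (g j))"
    by (simp add: C_def s_def)
qed

lemma ln_perm_const_convex:
  "convex_on {0<..1} (\<lambda>s. ln (perm_const TYPE('n::finite) (1 / s)))"
proof (rule convex_onI)
  fix t x y :: real
  assume t: "0 < t" "t < 1" and "x \<in> {0<..1}" "y \<in> {0<..1}"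
  then have x: "0 < x" "x \<le> 1" and y: "0 < y" "y \<le> 1"
    by auto
  define C where "C = (\<lambda>r. perm_const TYPE('n) (1 / r))"
  have C: "C r > 0" if "0 < r" "r \<le> 1" for r
    using perm_const_ge_1[where 'n = 'n, of "1 / r"] that by (simp add: C_def)
  have "0 < (1 - t) * x + t * y" "(1 - t) * x + t * y \<le> 1"
    using x y t convex_bound_le[of x 1 y "1 - t" t] by (simp_all add: add_pos_pos)
  then have "C ((1 - t) * x + t * y) > 0"
    by (rule C)
  moreover have "C ((1 - t) * x + t * y) \<le> C x powr (1 - t) * C y powr t"
    unfolding C_def using x y t by (rule perm_const_interpolate)
  ultimately have "ln (C ((1 - t) * x + t * y)) \<le> ln (C x powr (1 - t) * C y powr t)"
    by (simp add: ln_mono)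
  also have "\<dots> = (1 - t) * ln (C x) + t * ln (C y)"
    using C[OF x] C[OF y] by (simp add: ln_mult)
  finally show "ln (perm_const TYPE('n) (1 / ((1 - t) *\<^sub>R x + t *\<^sub>R y)))
      \<le> (1 - t) * ln (perm_const TYPE('n) (1 / x)) + t * ln (perm_const TYPE('n) (1 / y))"
    by (simp add: C_def)
qed simp

section \<open>The endpoint with exponent one\<close>

lemma perm_const_1_le: "perm_const TYPE('n::finite) 1 \<le> 1"
proof (rule perm_const_leI)
  fix g :: "'n \<Rightarrow> real ^ 'n"
  assume nonneg: "\<And>j k. g j $ k \<ge> 0"
  have "rperm g \<le> (\<Sum>\<sigma>\<in>UNIV. \<Prod>j\<in>UNIV. g j $ \<sigma> j)"
    unfolding rperm_def by (intro sum_mono2 prod_nonneg) (use nonneg in auto)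
  also have "\<dots> = (\<Prod>j\<in>UNIV. \<Sum>k\<in>UNIV. g j $ k)"
    by (subst prod_sum_PiE) auto
  also have "\<dots> = (\<Prod>j\<in>UNIV. pnorm 1 (g j))"
    using nonneg by (simp add: pnorm_def sum_nonneg)
  finally show "rperm g \<le> 1 * (\<Prod>j\<in>UNIV. pnorm 1 (g j))"
    by simp
qed simp

section \<open>The endpoint with exponent two\<close>

definition nonneg_unit :: "real ^ 'n::finite \<Rightarrow> bool" where
  "nonneg_unit x \<longleftrightarrow> (\<forall>k. x $ k \<ge> 0) \<and> norm x = 1"

definition maximizer :: "('n::finite \<Rightarrow> real ^ 'n) \<Rightarrow> bool" where
  "maximizer g \<longleftrightarrow> (\<forall>j. nonneg_unit (g j)) \<and>
     (\<forall>h :: 'n \<Rightarrow> real ^ 'n. (\<forall>j. nonneg_unit (h j)) \<longrightarrow> rperm h \<le> rperm g)"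

lemma nonneg_unit_normalize:
  fixes z :: "real ^ 'n::finite"
  assumes "\<And>k. z $ k \<ge> 0" and "z \<noteq> 0"
  shows "nonneg_unit ((1 / norm z) *\<^sub>R z)"
  using assms by (simp add: nonneg_unit_def)

text \<open>Where a linear functional attains its norm at a unit vector, it is a multiple of the inner
  product with that vector. Nonnegative test vectors suffice because the representing vector is
  itself one.\<close>

lemma maximizer_column:
  fixes g :: "'n::finite \<Rightarrow> real ^ 'n"
  assumes g: "maximizer g"
  shows "rperm (g(i := z)) = rperm g * (g i \<bullet> z)"
proof -
  have unit: "nonneg_unit (g j)" for j
    using g by (simp add: maximizer_def)
  have "g j $ k \<ge> 0" for j k
    using unit by (simp add: nonneg_unit_def)
  then obtain v where v_nonneg: "\<And>k. v $ k \<ge> 0" and v: "\<And>z. rperm (g(i := z)) = v \<bullet> z"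
    using rperm_linear_in_column[of g i] by metis
  define M where "M = rperm g"
  have vg: "v \<bullet> g i = M"
    using v[of "g i"] by (simp add: M_def)
  have "M \<ge> 0"
    unfolding M_def using \<open>\<And>j k. g j $ k \<ge> 0\<close> by (rule rperm_nonneg)
  have "norm v \<le> M"
  proof (cases "v = 0")
    case False
    have "\<forall>j. nonneg_unit ((g(i := (1 / norm v) *\<^sub>R v)) j)"
      using unit nonneg_unit_normalize[OF v_nonneg False] by simp
    then have "rperm (g(i := (1 / norm v) *\<^sub>R v)) \<le> M"
      using g unfolding maximizer_def M_def by blast
    then show ?thesis
      using False by (simp add: v power2_norm_eq_inner[symmetric] power2_eq_square)
  qed (use \<open>M \<ge> 0\<close> in simp)
  have gi: "g i \<bullet> g i = 1"
    using unit[of i] by (simp add: nonneg_unit_def norm_eq_1)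
  have "(norm (v - M *\<^sub>R g i))\<^sup>2 = (norm v)\<^sup>2 - M\<^sup>2"
  proof -
    have "(norm (v - M *\<^sub>R g i))\<^sup>2 = v \<bullet> v - 2 * M * (v \<bullet> g i) + M\<^sup>2 * (g i \<bullet> g i)"
      unfolding power2_norm_eq_inner
      by (simp add: inner_diff inner_commute algebra_simps power2_eq_square)
    then show ?thesis
      by (simp only: power2_norm_eq_inner vg gi) (simp add: power2_eq_square)
  qed
  also have "\<dots> \<le> 0"
    using \<open>norm v \<le> M\<close> by (simp add: power_mono)
  finally have "v = M *\<^sub>R g i"
    by simp
  then show ?thesis
    by (simp add: v M_def)
qed

text \<open>Write \<open>B\<close> for the permanent as a symmetric bilinear function of the columns \<open>i\<close> and \<open>j\<close>, and \<open>M\<close>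
  for its maximum. Then \<open>B(z, y) = M (z \<bullet> x)\<close> and \<open>B(x, z) = M (z \<bullet> y)\<close>, so
  \<open>B(x + y, x + y) = M (2 + 2 (x \<bullet> y)) = M |x + y|\<^sup>2\<close>.\<close>

lemma maximizer_merge:
  fixes g :: "'n::finite \<Rightarrow> real ^ 'n"
  assumes g: "maximizer g" and ij: "i \<noteq> j"
  defines "w \<equiv> (1 / norm (g i + g j)) *\<^sub>R (g i + g j)"
  shows "maximizer (g(i := w, j := w))"
proof -
  define x y M where "x = g i" and "y = g j" and "M = rperm g"
  have unit: "nonneg_unit (g k)" for k
    using g by (simp add: maximizer_def)
  have nonneg: "x $ k \<ge> 0" "y $ k \<ge> 0" for k
    using unit by (simp_all add: x_def y_def nonneg_unit_def)
  have xx: "x \<bullet> x = 1" and yy: "y \<bullet> y = 1"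
    using unit[of i] unit[of j] by (simp_all add: x_def y_def nonneg_unit_def norm_eq_1)
  have "x \<bullet> y \<ge> 0"
    unfolding inner_vec_def by (intro sum_nonneg) (simp add: nonneg)
  have norm_xy: "(norm (x + y))\<^sup>2 = 2 + 2 * (x \<bullet> y)"
    by (simp add: power2_norm_eq_inner inner_add xx yy inner_commute)
  then have "x + y \<noteq> 0"
    using \<open>x \<bullet> y \<ge> 0\<close> by auto
  define B where "B = (\<lambda>p q. rperm (g(i := p, j := q)))"
  have B_sym: "B p q = B q p" for p q
    unfolding B_def using ij by (rule rperm_swap)
  have B_x: "B x q = M * (y \<bullet> q)" for q
    using maximizer_column[OF g, of j q] by (simp add: B_def x_def y_def M_def)
  have B_y: "B p y = M * (x \<bullet> p)" for p
    using maximizer_column[OF g, of i p] ij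
    by (simp add: B_def x_def y_def M_def fun_upd_idem)
  have w_unit: "nonneg_unit w"
    unfolding w_def x_def[symmetric] y_def[symmetric]
    by (rule nonneg_unit_normalize) (use nonneg \<open>x + y \<noteq> 0\<close> in \<open>auto simp: add_nonneg_nonneg\<close>)
  have "B w w = M"
  proof -
    define c where "c = 1 / norm (x + y)"
    have w: "w = c *\<^sub>R x + c *\<^sub>R y"
      by (simp add: w_def x_def y_def c_def scaleR_add_right)
    have w_nonneg: "w $ k \<ge> 0" for k
      using w_unit by (simp add: nonneg_unit_def)
    have "(g(i := w)) k $ l \<ge> 0" for k l
      using unit w_nonneg by (simp add: nonneg_unit_def)
    then obtain v where v: "\<And>z. B w z = v \<bullet> z"
      using rperm_linear_in_column[of "g(i := w)" j] unfolding B_def by metis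
    have "B w w = c * B w x + c * B w y"
      unfolding v by (subst (1) w) (simp add: inner_add_right)
    also have "\<dots> = c * (M * (y \<bullet> w)) + c * (M * (x \<bullet> w))"
      by (simp only: B_sym[of w x] B_x B_y)
    also have "\<dots> = M * (c\<^sup>2 * (2 + 2 * (x \<bullet> y)))"
      by (simp add: w inner_add_right xx yy inner_commute[of y x] algebra_simps power2_eq_square)
    also have "\<dots> = M"
      using \<open>x + y \<noteq> 0\<close> by (simp add: norm_xy[symmetric] c_def power_divide)
    finally show ?thesis .
  qed
  then show ?thesis
    using g w_unit unfolding maximizer_def B_def M_def by auto
qed

definition entry_sum :: "('n::finite \<Rightarrow> real ^ 'n) \<Rightarrow> real" where
  "entry_sum g = (\<Sum>j\<in>UNIV. \<Sum>k\<in>UNIV. g j $ k)"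

text \<open>The two new columns add up to \<open>2 w = (2 / |x + y|) (x + y)\<close>, a multiple of \<open>x + y\<close> with a factor
  above \<open>1\<close>, because \<open>|x + y| < 2\<close> for distinct unit vectors. Nonnegativity makes
  the entry sum of \<open>x + y\<close> positive, so that the factor really increases it.\<close>

lemma entry_sum_merge_less:
  fixes g :: "'n::finite \<Rightarrow> real ^ 'n"
  assumes g: "\<And>k. nonneg_unit (g k)" and ij: "i \<noteq> j" and ne: "g i \<noteq> g j"
  defines "w \<equiv> (1 / norm (g i + g j)) *\<^sub>R (g i + g j)"
  shows "entry_sum g < entry_sum (g(i := w, j := w))"
proof -
  define x y where "x = g i" and "y = g j"
  define \<Sigma> where "\<Sigma> = (\<lambda>z :: real ^ 'n. \<Sum>k\<in>UNIV. z $ k)"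
  have nonneg: "x $ k \<ge> 0" "y $ k \<ge> 0" for k
    using g by (simp_all add: x_def y_def nonneg_unit_def)
  have norm1: "norm x = 1" "norm y = 1"
    using g by (simp_all add: x_def y_def nonneg_unit_def)
  have "x \<bullet> y \<ge> 0"
    unfolding inner_vec_def by (intro sum_nonneg) (simp add: nonneg)
  have norm_add: "(norm (x + y))\<^sup>2 = 2 + 2 * (x \<bullet> y)"
    and norm_diff: "(norm (x - y))\<^sup>2 = 2 - 2 * (x \<bullet> y)"
    using norm1 by (simp_all add: power2_norm_eq_inner inner_add inner_diff norm_eq_1 inner_commute)
  have "x + y \<noteq> 0"
    using norm_add \<open>x \<bullet> y \<ge> 0\<close> by auto
  \<comment> \<open>strict convexity of the unit ball\<close>
  have "(norm (x + y))\<^sup>2 < 2\<^sup>2"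
    using norm_add norm_diff ne zero_less_power[of "norm (x - y)" 2] by (simp add: x_def y_def)
  then have less2: "norm (x + y) < 2"
    by (rule power2_less_imp_less) simp
  have "\<Sigma> (x + y) > 0"
  proof -
    obtain k where "(x + y) $ k \<noteq> 0"
      using \<open>x + y \<noteq> 0\<close> by (auto simp: vec_eq_iff)
    then have "(x + y) $ k > 0"
      using nonneg[of k] by auto
    then show ?thesis
      unfolding \<Sigma>_def using nonneg
      by (intro sum_pos2[of UNIV k]) (auto simp: add_nonneg_nonneg)
  qed
  have split: "entry_sum h = \<Sigma> (h i) + \<Sigma> (h j) + (\<Sum>k\<in>UNIV - {i, j}. \<Sigma> (h k))" for h
  proof -
    have "entry_sum h = (\<Sum>k\<in>UNIV - {i, j}. \<Sigma> (h k)) + (\<Sum>k\<in>{i, j}. \<Sigma> (h k))"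
      unfolding entry_sum_def \<Sigma>_def by (rule sum.subset_diff) auto
    then show ?thesis
      using ij by simp
  qed
  have "\<Sigma> x + \<Sigma> y = \<Sigma> (x + y)"
    by (simp add: \<Sigma>_def sum.distrib)
  also have "\<dots> < 2 * (\<Sigma> (x + y) / norm (x + y))"
    using less2 \<open>\<Sigma> (x + y) > 0\<close> \<open>x + y \<noteq> 0\<close> by (simp add: pos_less_divide_eq mult.commute)
  also have "\<Sigma> (x + y) / norm (x + y) = \<Sigma> w"
    by (simp add: \<Sigma>_def w_def x_def y_def sum_divide_distrib)
  finally have "\<Sigma> (g i) + \<Sigma> (g j) < 2 * \<Sigma> w"
    by (simp add: x_def y_def)
  moreover have "(\<Sum>k\<in>UNIV - {i, j}. \<Sigma> ((g(i := w, j := w)) k)) = (\<Sum>k\<in>UNIV - {i, j}. \<Sigma> (g k))"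
    by (intro sum.cong) auto
  ultimately show ?thesis
    using ij by (simp add: split)
qed

text \<open>Two successive maximizations, of the permanent over all nonnegative unit columns and of the entry
  sum over the compact set of maximizers, give a maximizer that merging cannot improve.\<close>

lemma exists_maximizer_with_equal_columns:
  obtains w :: "real ^ 'n::finite" where "maximizer (\<lambda>_ :: 'n. w)"
proof -
  \<comment> \<open>Families of columns are packed into vectors \<open>F\<close>, where closed bounded sets are compact.\<close>
  define K :: "(real ^ 'n ^ 'n) set" where "K = {F. \<forall>j. nonneg_unit (F $ j)}"
  have K_eq: "K = {F. (\<forall>j k. 0 \<le> F $ j $ k) \<and> (\<forall>j. norm (F $ j) = 1)}"
    by (auto simp: K_def nonneg_unit_def)
  have "closed K"
    unfolding K_eq
    by (intro closed_Collect_conj closed_Collect_all closed_Collect_le closed_Collect_eq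
        continuous_intros)
  moreover have "bounded K"
  proof (rule boundedI)
    fix F assume "F \<in> K"
    have "norm F \<le> (\<Sum>j\<in>UNIV. norm (F $ j))"
      by (simp add: norm_vec_def L2_set_le_sum)
    then show "norm F \<le> real CARD('n)"
      using \<open>F \<in> K\<close> by (simp add: K_eq)
  qed
  ultimately have "compact K"
    by (simp add: compact_eq_bounded_closed)
  have "(\<chi> j. axis j 1) \<in> K"
    by (auto simp: K_def nonneg_unit_def axis_def norm_axis_1[unfolded axis_def])
  then have "K \<noteq> {}"
    by blast
  have cont: "continuous_on S (\<lambda>F :: real ^ 'n ^ 'n. rperm (($) F))" for S
    unfolding rperm_def by (intro continuous_intros)
  obtain F0 where "F0 \<in> K" and F0: "\<And>F. F \<in> K \<Longrightarrow> rperm (($) F) \<le> rperm (($) F0)"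
    using continuous_attains_sup[OF \<open>compact K\<close> \<open>K \<noteq> {}\<close> cont] by blast
  define K' where "K' = K \<inter> {F. rperm (($) F0) \<le> rperm (($) F)}"
  have "closed {F :: real ^ 'n ^ 'n. rperm (($) F0) \<le> rperm (($) F)}"
    by (intro closed_Collect_le continuous_on_const cont)
  then have "compact K'"
    unfolding K'_def by (rule compact_Int_closed[OF \<open>compact K\<close>])
  have "K' \<noteq> {}"
    using \<open>F0 \<in> K\<close> by (auto simp: K'_def)
  have "continuous_on K' (\<lambda>F. entry_sum (($) F))"
    unfolding entry_sum_def by (intro continuous_intros)
  then obtain F1 where "F1 \<in> K'"
    and F1: "\<And>F. F \<in> K' \<Longrightarrow> entry_sum (($) F) \<le> entry_sum (($) F1)"
    using continuous_attains_sup[OF \<open>compact K'\<close> \<open>K' \<noteq> {}\<close>] by metis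
  have K'_iff: "(\<chi> j. h j) \<in> K' \<longleftrightarrow> maximizer h" for h :: "'n \<Rightarrow> real ^ 'n"
  proof -
    have K_iff: "(\<chi> j. h' j) \<in> K \<longleftrightarrow> (\<forall>j. nonneg_unit (h' j))" for h' :: "'n \<Rightarrow> real ^ 'n"
      by (simp add: K_def)
    have columns: "($) (\<chi> j. h' j) = h'" for h' :: "'n \<Rightarrow> real ^ 'n"
      by (simp add: fun_eq_iff)
    have F0_max: "rperm h' \<le> rperm (($) F0)" if "\<forall>j. nonneg_unit (h' j)"
      for h' :: "'n \<Rightarrow> real ^ 'n"
      using F0[OF iffD2[OF K_iff that]] by (simp only: columns)
    have F0_unit: "\<forall>j. nonneg_unit (F0 $ j)"
      using \<open>F0 \<in> K\<close> by (simp add: K_def)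
    have "(\<chi> j. h j) \<in> K' \<longleftrightarrow>
        (\<forall>j. nonneg_unit (h j)) \<and> rperm (($) F0) \<le> rperm h"
      by (simp only: K'_def Int_iff mem_Collect_eq K_iff columns)
    also have "\<dots> \<longleftrightarrow> maximizer h"
      unfolding maximizer_def using F0_max F0_unit by (meson order.trans)
    finally show ?thesis .
  qed
  define g where "g = ($) F1"
  have F1_eq: "F1 = (\<chi> j. g j)"
    by (simp add: g_def)
  have g: "maximizer g"
    using K'_iff[of g] \<open>F1 \<in> K'\<close> by (simp add: F1_eq)
  have g_max: "entry_sum h \<le> entry_sum g" if "maximizer h" for h :: "'n \<Rightarrow> real ^ 'n"
    using F1[of "\<chi> j. h j"] K'_iff[of h] that by (simp add: g_def entry_sum_def)
  have eq: "g i = g j" for i j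
  proof (rule ccontr)
    assume ne: "g i \<noteq> g j"
    then have "i \<noteq> j"
      by auto
    moreover have "nonneg_unit (g k)" for k
      using g by (simp add: maximizer_def)
    ultimately show False
      using entry_sum_merge_less[of g i j] ne g_max[OF maximizer_merge[OF g \<open>i \<noteq> j\<close>]] by simp
  qed
  have "g = (\<lambda>_. g undefined)"
    using eq by (simp add: fun_eq_iff)
  with g that show thesis
    by metis
qed

text \<open>The inequality of the means, applied to the squares of the entries.\<close>

lemma prod_entries_le:
  fixes w :: "real ^ 'n::finite"
  assumes "nonneg_unit w"
  shows "(\<Prod>k\<in>UNIV. w $ k) \<le> 1 / real CARD('n) powr (real CARD('n) / 2)"
proof -
  define N where "N = real CARD('n)"
  have "N > 0"
    by (simp add: N_def)
  define P where "P = (\<Prod>k\<in>UNIV. w $ k)"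
  have nonneg: "w $ k \<ge> 0" for k
    using assms by (simp add: nonneg_unit_def)
  then have "P \<ge> 0"
    unfolding P_def by (intro prod_nonneg) auto
  have "w \<bullet> w = 1"
    using assms by (simp add: nonneg_unit_def norm_eq_1)
  then have sum1: "(\<Sum>k\<in>UNIV. (w $ k)\<^sup>2) = 1"
    by (simp add: inner_vec_def power2_eq_square)
  have "(\<Prod>k\<in>UNIV. (w $ k)\<^sup>2) powr (1 / N) \<le> (\<Sum>k\<in>UNIV. (w $ k)\<^sup>2 / N)"
    unfolding N_def by (rule arith_geom_mean) auto
  then have "(P\<^sup>2) powr (1 / N) \<le> 1 / N"
    by (simp add: P_def prod_power_distrib sum_divide_distrib[symmetric] sum1)
  then have "((P\<^sup>2) powr (1 / N)) powr (N / 2) \<le> (1 / N) powr (N / 2)"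
    using \<open>N > 0\<close> by (intro powr_mono2) auto
  also have "((P\<^sup>2) powr (1 / N)) powr (N / 2) = P"
    using \<open>P \<ge> 0\<close> \<open>N > 0\<close> by (simp add: powr_powr powr_half_sqrt)
  finally show ?thesis
    using \<open>N > 0\<close> by (simp add: P_def N_def powr_divide)
qed

lemma perm_const_2_le:
  "perm_const TYPE('n::finite) 2 \<le> fact CARD('n) / real CARD('n) powr (real CARD('n) / 2)"
proof (rule perm_const_leI)
  define B where "B = fact CARD('n) / real CARD('n) powr (real CARD('n) / 2)"
  obtain w :: "real ^ 'n" where w: "maximizer (\<lambda>_ :: 'n. w)"
    by (rule exists_maximizer_with_equal_columns)
  have w_le: "rperm (\<lambda>_ :: 'n. w) \<le> B"
  proof -
    have "(\<Prod>k\<in>UNIV. w $ k) \<le> 1 / real CARD('n) powr (real CARD('n) / 2)"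
      using w by (intro prod_entries_le) (simp add: maximizer_def)
    then have "fact CARD('n) * (\<Prod>k\<in>UNIV. w $ k)
        \<le> fact CARD('n) * (1 / real CARD('n) powr (real CARD('n) / 2))"
      by (rule mult_left_mono) simp
    then show ?thesis
      by (simp add: rperm_diagonal B_def)
  qed
  fix g :: "'n \<Rightarrow> real ^ 'n"
  assume nonneg: "\<And>j k. g j $ k \<ge> 0" and nz: "\<And>j. g j \<noteq> 0"
  define h where "h = (\<lambda>j. (1 / norm (g j)) *\<^sub>R g j)"
  have "nonneg_unit (h j)" for j
    unfolding h_def using nonneg nz by (rule nonneg_unit_normalize)
  then have "rperm h \<le> rperm (\<lambda>_ :: 'n. w)"
    using w unfolding maximizer_def by blast
  then have "rperm h \<le> B"
    using w_le by simp
  have pnorm_2: "pnorm 2 (g j) = norm (g j)" for j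
    using nonneg by (simp add: pnorm_def norm_vec_def L2_set_def powr_half_sqrt sum_nonneg)
  have "g = (\<lambda>j. norm (g j) *\<^sub>R h j)"
    using nz by (simp add: h_def fun_eq_iff)
  then have "rperm g = (\<Prod>j\<in>UNIV. norm (g j)) * rperm h"
    by (metis rperm_scale)
  also have "\<dots> \<le> (\<Prod>j\<in>UNIV. norm (g j)) * B"
    using \<open>rperm h \<le> B\<close> by (intro mult_left_mono prod_nonneg) auto
  finally show "rperm g \<le> fact CARD('n) / real CARD('n) powr (real CARD('n) / 2)
      * (\<Prod>j\<in>UNIV. pnorm 2 (g j))"
    by (simp add: pnorm_2 B_def mult.commute)
qed simp

section \<open>Convexity and the bound between the endpoints\<close>

theorem theorem4p1:
  shows "convex_on {0<..1} (\<lambda>s. ln (perm_const TYPE('n::finite) (1 / s)))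
    \<and> (\<forall>p::real. 1 \<le> p \<and> p \<le> 2 \<longrightarrow>
         perm_const TYPE('n) p
           \<le> (fact CARD('n) / real CARD('n) powr (real CARD('n) / 2)) powr (2 - 2 / p))"
proof (intro conjI allI impI)
  show convex: "convex_on {0<..1} (\<lambda>s. ln (perm_const TYPE('n) (1 / s)))"
    by (rule ln_perm_const_convex)
  fix p :: real
  assume p: "1 \<le> p \<and> p \<le> 2"
  define B where "B = fact CARD('n) / real CARD('n) powr (real CARD('n) / 2)"
  define t where "t = 2 - 2 / p"
  have t: "0 \<le> t" "t \<le> 1"
    using p by (simp_all add: t_def field_simps)
  have C: "perm_const TYPE('n) q \<ge> 1" if "q \<ge> 1" for q
    using that by (rule perm_const_ge_1)
  have C1: "perm_const TYPE('n) 1 = 1"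
    using perm_const_1_le[where 'n = 'n] C[of 1] by simp
  have "(1 - t) *\<^sub>R 1 + t *\<^sub>R (1 / 2) = 1 / p"
    using p by (simp add: t_def field_simps)
  then have "ln (perm_const TYPE('n) p) \<le> t * ln (perm_const TYPE('n) 2)"
    using convex_onD[OF convex t, of 1 "1 / 2"] by (simp add: C1)
  also have "\<dots> = ln (perm_const TYPE('n) 2 powr t)"
    using C[of 2] by (simp add: ln_powr)
  finally have "perm_const TYPE('n) p \<le> perm_const TYPE('n) 2 powr t"
    using C[of p] C[of 2] p by (subst (asm) ln_le_cancel_iff) auto
  also have "\<dots> \<le> B powr t"
    using perm_const_2_le[where 'n = 'n] C[of 2] t by (intro powr_mono2) (auto simp: B_def)
  finally show "perm_const TYPE('n) p
      \<le> (fact CARD('n) / real CARD('n) powr (real CARD('n) / 2)) powr (2 - 2 / p)"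
    by (simp add: B_def t_def)
qed

end
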